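(* Let $q$ be a prime power and let $n\geq 2$ be an integer. The number of distance vectors in $\mathcal{D}(n)$, the set of distance vectors for the full flag variety on $\mathbb{F}_q^n$, is the $n$-th Motzkin number $M_n$.
   Context: Let $\mathbb{F}_q$ be the finite field with $q$ elements. A full flag on $\mathbb{F}_q^n$ is a sequence $\mathcal{F}=(\mathcal{F}_1,\dots,\mathcal{F}_{n-1})$ of $\mathbb{F}_q$-subspaces of $\mathbb{F}_q^n$ with $\mathcal{F}_1\subsetneq\cdots\subsetneq\mathcal{F}_{n-1}$ and $\dim \mathcal{F}_i=i$ for every $i$; the set of all full flags is the full flag variety $\mathcal{F}_q(n)$. For subspaces $\mathcal{U},\mathcal{V}$ of the same dimension $k$, the injection distance is $d_I(\mathcal{U},\mathcal{V})=k-\dim(\mathcal{U}\cap\mathcal{V})$. The distance vector of $\mathcal{F},\mathcal{F}'\in\mathcal{F}_q(n)$ is $\mathbf{d}(\mathcal{F},\mathcal{F}')=(d_I(\mathcal{F}_1,\mathcal{F}'_1),\dots,d_I(\mathcal{F}_{n-1},\mathcal{F}'_{n-1}))\in\mathbb{Z}^{n-1}$, and $\mathcal{D}(n)=\{\mathbf{d}(\mathcal{F},\mathcal{F}') \mid \mathcal{F},\mathcal{F}'\in\mathcal{F}_q(n)\}$ (pairs with $\mathcal{F}=\mathcal{F}'$ are allowed, so the zero vector belongs to $\mathcal{D}(n)$). The Motzkin numbers are given by $M_0=1$ and $M_n=M_{n-1}+\sum_{k=0}^{n-2}M_kM_{n-k-2}$ for $n\geq 1$ (the sum being empty for $n=1$).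 It is well known that $M_n$ is the number of Motzkin paths of length $n$, i.e. lattice paths from $(0,0)$ to $(n,0)$ with steps $(1,1)$, $(1,-1)$, $(1,0)$ that never run below the $x$-axis. *)

theory Defs
  imports "HOL-Analysis.Cartesian_Space"
begin

text \<open>
  The field \<open>\<F>\<^sub>q\<close> is any type \<open>'a::{field,finite}\<close> with \<open>q = CARD('a)\<close>, and \<open>\<F>\<^sub>q\<^sup>n\<close> is
  \<open>'a ^ 'n\<close> with \<open>n = CARD('n)\<close>. Finite sequences of length \<open>n - 1\<close> are lists; as lists are
  indexed from 0, the entry at position \<open>i\<close> is the component with index \<open>i + 1\<close>.
\<close>

definition full_flags :: "('a::field ^ 'n) set list set" where
  "full_flags = {F. length F = CARD('n) - 1 \<and> sorted_wrt (\<subset>) F \<and>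
     (\<forall>i<length F. vec.subspace (F ! i) \<and> vec.dim (F ! i) = i + 1)}"

text \<open>Only meant for subspaces \<open>U\<close>, \<open>V\<close> of equal dimension.\<close>

definition injection_dist :: "('a::field ^ 'n) set \<Rightarrow> ('a ^ 'n) set \<Rightarrow> int" where
  "injection_dist U V = int (vec.dim U) - int (vec.dim (U \<inter> V))"

definition distance_vector :: "('a::field ^ 'n) set list \<Rightarrow> ('a ^ 'n) set list \<Rightarrow> int list" where
  "distance_vector F F' = map2 injection_dist F F'"

definition distance_vectors :: "'a::field itself \<Rightarrow> 'n::finite itself \<Rightarrow> int list set" where
  "distance_vectors _ _ =
     {distance_vector F F' | F F'. F \<in> (full_flags :: ('a ^ 'n) set list set) \<and> F' \<in> full_flags}"

text \<open>
  The second equation is \<open>M\<^sub>n = M\<^bsub>n-1\<^esub> + (\<Sum>k=0..n-2. M\<^sub>k M\<^bsub>n-k-2\<^esub>)\<close> with \<open>n = m + 1\<close>; for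
  \<open>m = 0\<close> the sum is empty.
\<close>

fun motzkin :: "nat \<Rightarrow> nat" where
  "motzkin 0 = 1"
| "motzkin (Suc m) = motzkin m + (\<Sum>k<m. motzkin k * motzkin (m - k - 1))"

end

theory Submission
  imports Defs "HOL-Computational_Algebra.Formal_Power_Series"
begin

text \<open>
  Put \<open>\<F>\<^sub>0 = 0\<close> and \<open>\<F>\<^sub>n = \<F>\<^sub>q\<^sup>n\<close>. The dimension of \<open>\<F>\<^sub>i \<inter> \<F>'\<^sub>i\<close> grows by 0, 1 or 2 when \<open>i\<close> grows by
  1, so a distance vector, extended by 0 at both ends, is a Motzkin path of length \<open>n\<close>. Conversely,
  a Motzkin path is realised by two flags of coordinate subspaces, that is, by two chains of sets of
  indices: a step up adds a fresh index to each set, two different ones; a level step adds the same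
  fresh index to both sets; a step down adds to each set an index that only the other one has. The
  path stays below \<open>n - i\<close>, so there are always enough fresh indices.

  For the count, let \<open>G\<close> be the generating function of the Motzkin numbers, so
  \<open>G = 1 + X G + X\<^sup>2 G\<^sup>2\<close>. Then \<open>X\<^sup>h G\<^bsup>h+1\<^esup>\<close> is the generating function of the paths from height
  \<open>h\<close> to height 0, because both satisfy the recursion given by the first step of the path.
\<close>

section \<open>Counting Motzkin paths\<close>

text \<open>Only the end \<open>y\<close> of a step has to be nonnegative: its start is either the
  natural number at which the path begins or the end of the previous step.\<close>

definition motzkin_step :: "int \<Rightarrow> int \<Rightarrow> bool" where
  "motzkin_step x y \<longleftrightarrow> 0 \<le> y \<and> \<bar>y - x\<bar> \<le> 1"

text \<open>Both end points of the path are omitted from the list, so the path has \<open>m + 1\<close> steps.\<close>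

definition motzkin_paths :: "nat \<Rightarrow> nat \<Rightarrow> int list set" where
  "motzkin_paths h m = {xs. length xs = m \<and> successively motzkin_step (int h # xs @ [0])}"

definition motzkin_fps :: "nat fps" where
  "motzkin_fps = Abs_fps motzkin"

lemma motzkin_fps_eq:
  "motzkin_fps = 1 + fps_X * motzkin_fps + fps_X ^ 2 * motzkin_fps ^ 2"
proof (rule fps_ext)
  fix n
  show "fps_nth motzkin_fps n = fps_nth (1 + fps_X * motzkin_fps + fps_X ^ 2 * motzkin_fps ^ 2) n"
  proof (cases n)
    case 0
    then show ?thesis by (simp add: motzkin_fps_def)
  next
    case (Suc m)
    have "fps_nth (fps_X ^ 2 * motzkin_fps ^ 2) (Suc m) = fps_nth (fps_X * (motzkin_fps * motzkin_fps)) m"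
      by (simp add: power2_eq_square mult.assoc)
    also have "\<dots> = (\<Sum>k<m. motzkin k * motzkin (m - k - 1))"
      \<comment> \<open>Both sides vanish for \<open>m = 0\<close>; otherwise the remaining factor
        \<open>fps_X\<close> leaves the convolution at index \<open>m - 1\<close>.\<close>
      by (subst fps_X_mult_nth, cases m)
        (simp_all add: fps_mult_nth motzkin_fps_def atLeast0AtMost lessThan_Suc_atMost)
    finally show ?thesis
      using Suc by (simp add: motzkin_fps_def)
  qed
qed

text \<open>Cutting a path from height \<open>h\<close> to 0 at its first visits to the heights
  below \<open>h\<close> gives \<open>h\<close> steps down, separated by \<open>h + 1\<close>
  Motzkin paths; hence the two exponents.\<close>

definition path_fps :: "nat \<Rightarrow> nat fps" where
  "path_fps h = fps_X ^ h * motzkin_fps ^ Suc h"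

lemma path_fps_0: "path_fps 0 = 1 + fps_X * (path_fps 0 + path_fps 1)"
  using motzkin_fps_eq by (simp add: path_fps_def power2_eq_square algebra_simps)

lemma path_fps_Suc:
  "path_fps (Suc h) = fps_X * (path_fps h + path_fps (Suc h) + path_fps (Suc (Suc h)))"
proof -
  have "path_fps (Suc h) = fps_X ^ Suc h * motzkin_fps ^ Suc h * motzkin_fps"
    by (simp add: path_fps_def algebra_simps)
  \<comment> \<open>Expanding one factor by the functional equation, its three summands account for
    a first step down, level and up, in this order.\<close>
  also have "\<dots> = fps_X ^ Suc h * motzkin_fps ^ Suc h *
      (1 + fps_X * motzkin_fps + fps_X ^ 2 * motzkin_fps ^ 2)"
    using motzkin_fps_eq by simp
  also have "\<dots> = fps_X * (path_fps h + path_fps (Suc h) + path_fps (Suc (Suc h)))"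
    by (simp add: path_fps_def power2_eq_square algebra_simps)
  finally show ?thesis .
qed

lemma path_fps_nth_0: "fps_nth (path_fps h) 0 = (if h = 0 then 1 else 0)"
  by (cases h) (simp_all add: path_fps_def motzkin_fps_def)

lemma path_fps_0_nth_Suc: "fps_nth (path_fps 0) (Suc m) = fps_nth (path_fps 0) m + fps_nth (path_fps 1) m"
  by (subst path_fps_0) simp

lemma path_fps_Suc_nth_Suc:
  "fps_nth (path_fps (Suc h)) (Suc m) = fps_nth (path_fps h) m + fps_nth (path_fps (Suc h)) m + fps_nth (path_fps (Suc (Suc h))) m"
  by (subst path_fps_Suc) simp

text \<open>Either side forces \<open>0 \<le> x\<close>, so \<open>nat x\<close> is the same height
  as \<open>x\<close>.\<close>

lemma Cons_mem_motzkin_paths: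
  "x # xs \<in> motzkin_paths h (Suc m) \<longleftrightarrow> motzkin_step (int h) x \<and> xs \<in> motzkin_paths (nat x) m"
  by (auto simp: motzkin_paths_def motzkin_step_def)

lemma Nil_notin_motzkin_paths_Suc: "[] \<notin> motzkin_paths h (Suc m)"
  by (simp add: motzkin_paths_def)

lemma motzkin_paths_Suc:
  "motzkin_paths h (Suc m) = (\<Union>x\<in>{x. motzkin_step (int h) x}. (#) x ` motzkin_paths (nat x) m)"
proof (rule set_eqI)
  fix ys
  show "ys \<in> motzkin_paths h (Suc m) \<longleftrightarrow>
      ys \<in> (\<Union>x\<in>{x. motzkin_step (int h) x}. (#) x ` motzkin_paths (nat x) m)"
    by (cases ys) (auto simp: Cons_mem_motzkin_paths Nil_notin_motzkin_paths_Suc)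
qed

lemma motzkin_steps_0: "{x. motzkin_step 0 x} = {0, 1}"
  by (auto simp: motzkin_step_def)

lemma motzkin_steps_Suc:
  "{x. motzkin_step (int (Suc h)) x} = {int h, int (Suc h), int (Suc (Suc h))}"
  by (auto simp: motzkin_step_def)

text \<open>The coefficient is at \<open>Suc m\<close> because \<open>m\<close> inner points make
  \<open>m + 1\<close> steps. Finiteness is carried through the induction for the cardinality of the
  union over the first step.\<close>

lemma finite_card_motzkin_paths:
  "finite (motzkin_paths h m) \<and> card (motzkin_paths h m) = fps_nth (path_fps h) (Suc m)"
proof (induction m arbitrary: h)
  case 0
  have "motzkin_paths h 0 = (if h \<le> 1 then {[]} else {})"
    by (auto simp: motzkin_paths_def motzkin_step_def)
  moreover have "fps_nth (path_fps h) (Suc 0) = (if h \<le> 1 then 1 else 0)"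
    by (cases h) (auto simp: path_fps_0_nth_Suc path_fps_Suc_nth_Suc path_fps_nth_0)
  ultimately show ?case by simp
next
  case (Suc m)
  let ?S = "{x. motzkin_step (int h) x}"
  have fin: "finite ?S"
    by (rule finite_subset[of _ "{0..int h + 1}"]) (auto simp: motzkin_step_def)
  have "card (motzkin_paths h (Suc m)) = (\<Sum>x\<in>?S. card ((#) x ` motzkin_paths (nat x) m))"
    unfolding motzkin_paths_Suc using Suc.IH fin by (intro card_UN_disjoint) auto
  also have "\<dots> = (\<Sum>x\<in>?S. fps_nth (path_fps (nat x)) (Suc m))"
    using Suc.IH by (simp add: card_image)
  also have "\<dots> = fps_nth (path_fps h) (Suc (Suc m))"
  proof (cases h)
    case 0
    then show ?thesis
      by (simp add: motzkin_steps_0 path_fps_0_nth_Suc[of "Suc m"])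
  next
    case (Suc k)
    then show ?thesis
      by (simp only: motzkin_steps_Suc path_fps_Suc_nth_Suc[of _ "Suc m"]) (simp add: nat_add_distrib)
  qed
  finally show ?case
    using Suc.IH fin by (simp add: motzkin_paths_Suc)
qed

lemma card_motzkin_paths: "card (motzkin_paths 0 m) = motzkin (Suc m)"
proof -
  have "path_fps 0 = motzkin_fps"
    by (simp add: path_fps_def)
  then show ?thesis
    using finite_card_motzkin_paths[of 0 m] by (simp add: motzkin_fps_def del: motzkin.simps)
qed

section \<open>Distance vectors are Motzkin paths\<close>

text \<open>The subspace \<open>U' \<inter> W\<close> meets \<open>U\<close> in
  \<open>U \<inter> W\<close>, and its sum with \<open>U\<close> stays inside \<open>U'\<close>; the
  dimension formula does the rest.\<close>

lemma dim_Int_le: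
  fixes U U' W :: "('a::field ^ 'n::finite) set"
  assumes "vec.subspace U" "vec.subspace U'" "vec.subspace W" "U \<subseteq> U'"
  shows "vec.dim (U' \<inter> W) + vec.dim U \<le> vec.dim (U \<inter> W) + vec.dim U'"
proof -
  have "vec.dim {x + y |x y. x \<in> U \<and> y \<in> U' \<inter> W} + vec.dim (U \<inter> (U' \<inter> W))
      = vec.dim U + vec.dim (U' \<inter> W)"
    using assms by (intro vec.dim_sums_Int vec.subspace_inter)
  moreover have "{x + y |x y. x \<in> U \<and> y \<in> U' \<inter> W} \<subseteq> U'"
    using assms by (auto intro: vec.subspace_add)
  moreover have "U \<inter> (U' \<inter> W) = U \<inter> W"
    using assms by auto
  ultimately show ?thesis
    using vec.dim_subset[of "{x + y |x y. x \<in> U \<and> y \<in> U' \<inter> W}" U'] by simp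
qed

text \<open>Enlarging first \<open>V\<close>, then \<open>U\<close>, adds at most 1 each time to the
  dimension of the intersection, while \<open>vec.dim U\<close> grows by exactly 1.\<close>

lemma motzkin_step_injection_dist:
  fixes U U' V V' :: "('a::field ^ 'n::finite) set"
  assumes sub: "vec.subspace U" "vec.subspace U'" "vec.subspace V" "vec.subspace V'"
    and mono: "U \<subseteq> U'" "V \<subseteq> V'"
    and dim: "vec.dim U' = Suc (vec.dim U)" "vec.dim V' = Suc (vec.dim V)"
  shows "motzkin_step (injection_dist U V) (injection_dist U' V')"
proof -
  have "vec.dim (U' \<inter> V') + vec.dim U \<le> vec.dim (U \<inter> V') + vec.dim U'"
    using sub mono by (intro dim_Int_le)
  moreover have "vec.dim (V' \<inter> U) + vec.dim V \<le> vec.dim (V \<inter> U) + vec.dim V'"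
    using sub mono by (intro dim_Int_le)
  moreover have "vec.dim (U \<inter> V) \<le> vec.dim (U' \<inter> V')"
    using mono by (intro vec.dim_subset) auto
  moreover have "vec.dim (U' \<inter> V') \<le> vec.dim U'"
    by (intro vec.dim_subset) auto
  ultimately show ?thesis
    using dim by (simp add: motzkin_step_def injection_dist_def Int_commute)
qed

text \<open>With the two trivial subspaces added, index and dimension agree, and the zeros at both
  ends of the path become distances as well.\<close>

definition extend_flag :: "('a::field ^ 'n) set list \<Rightarrow> ('a ^ 'n) set list" where
  "extend_flag F = {0} # F @ [UNIV]"

lemma extend_flag_nth:
  fixes F :: "('a::field ^ 'n::finite) set list"
  assumes "F \<in> full_flags" "i \<le> CARD('n)"
  shows "vec.subspace (extend_flag F ! i)" "vec.dim (extend_flag F ! i) = i"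
proof -
  have "length F = CARD('n) - 1" "\<And>j. j < length F \<Longrightarrow> vec.subspace (F ! j) \<and> vec.dim (F ! j) = j + 1"
    using assms(1) by (auto simp: full_flags_def)
  moreover have "0 < CARD('n)" by simp
  ultimately show "vec.subspace (extend_flag F ! i)" "vec.dim (extend_flag F ! i) = i"
    using assms(2) by (auto simp: extend_flag_def nth_Cons nth_append vec.subspace_0
        card_cart_basis split: nat.split)
qed

lemma extend_flag_mono:
  fixes F :: "('a::field ^ 'n::finite) set list"
  assumes "F \<in> full_flags" "i < CARD('n)"
  shows "extend_flag F ! i \<subseteq> extend_flag F ! Suc i"
proof -
  have len: "length F = CARD('n) - 1" and srt: "sorted_wrt (\<subset>) F"
    using assms(1) by (auto simp: full_flags_def)
  show ?thesis
  proof (cases i)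
    case 0
    have "0 \<in> extend_flag F ! Suc 0"
      using extend_flag_nth(1)[OF assms(1), of 1] vec.subspace_0 by force
    then show ?thesis
      using 0 by (simp add: extend_flag_def)
  next
    case (Suc j)
    show ?thesis
    proof (cases "Suc j < length F")
      case True
      then have "F ! j \<subset> F ! Suc j"
        using srt by (simp add: sorted_wrt_nth_less)
      then show ?thesis
        using Suc True by (auto simp: extend_flag_def nth_append)
    next
      case False
      then show ?thesis
        using Suc len assms(2) by (simp add: extend_flag_def nth_append)
    qed
  qed
qed

lemma distance_vector_in_motzkin_paths:
  fixes F F' :: "('a::field ^ 'n::finite) set list"
  assumes F: "F \<in> full_flags" and F': "F' \<in> full_flags"
  shows "distance_vector F F' \<in> motzkin_paths 0 (CARD('n) - 1)"
proof -
  let ?d = "0 # distance_vector F F' @ [0]"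
  have len: "length F = CARD('n) - 1" "length F' = CARD('n) - 1"
    using F F' by (auto simp: full_flags_def)
  have "?d = map2 injection_dist (extend_flag F) (extend_flag F')"
    using len by (simp add: extend_flag_def distance_vector_def injection_dist_def)
  moreover have "length (extend_flag F) = Suc (CARD('n))" "length (extend_flag F') = Suc (CARD('n))"
    using len by (simp_all add: extend_flag_def)
  ultimately have "successively motzkin_step ?d"
    by (simp only: successively_conv_nth)
      (simp add: motzkin_step_injection_dist extend_flag_nth extend_flag_mono F F')
  then show ?thesis
    using len by (simp add: motzkin_paths_def distance_vector_def)
qed

section \<open>Motzkin paths are distance vectors\<close>

text \<open>The complement of \<open>A \<union> B\<close> has \<open>CARD('n) - i - a\<close>
  elements, which by the bound is at least 2 for a step up and at least 1 for a level step.\<close>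

lemma extend_sets_along_step:
  fixes A B :: "'n::finite set"
  assumes card: "card A = i" "card B = i" "int (card (A \<inter> B)) = int i - a"
    and step: "motzkin_step a b" and bound: "int (Suc i) + b \<le> int (CARD('n))"
  obtains A' B' where "A \<subseteq> A'" "B \<subseteq> B'" "card A' = Suc i" "card B' = Suc i"
    "int (card (A' \<inter> B')) = int (Suc i) - b"
proof -
  have Un: "int (card (A \<union> B)) = int i + a"
    using card card_Un_Int[of A B] by simp
  have "card (A \<union> B) + card (- (A \<union> B)) = CARD('n)"
    using card_Un_disjoint[of "A \<union> B" "- (A \<union> B)"]
    by (simp only: Compl_partition Compl_disjoint finite)
  then have co: "int (card (- (A \<union> B))) = int (CARD('n)) - int i - a"
    using Un by linarith
  consider "b = a + 1" | "b = a" | "b = a - 1"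
    using step by (force simp: motzkin_step_def)
  then show thesis
  proof cases
    case 1
    then have "2 \<le> card (- (A \<union> B))"
      using co bound by simp
    then obtain x y where "{x, y} \<subseteq> - (A \<union> B)" "x \<noteq> y"
      by (metis card_2_iff obtain_subset_with_card_n)
    then have xy: "x \<notin> A" "x \<notin> B" "y \<notin> A" "y \<notin> B" "x \<noteq> y"
      by auto
    then have "insert x A \<inter> insert y B = A \<inter> B"
      by auto
    then show thesis
      using that[of "insert x A" "insert y B"] xy card 1 by auto
  next
    case 2
    then have "0 < card (- (A \<union> B))"
      using co bound by simp
    then obtain x where x: "x \<notin> A" "x \<notin> B"
      by (auto simp: card_gt_0_iff)
    then have "insert x A \<inter> insert x B = insert x (A \<inter> B)"
      by auto
    then show thesis
      using that[of "insert x A" "insert x B"] x card 2 by auto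
  next
    case 3
    \<comment> \<open>Here \<open>0 \<le> b\<close> gives \<open>1 \<le> a\<close>, so each set has
      an element outside the other. Exchanging such elements enlarges the intersection by 2.\<close>
    then have "card (A \<inter> B) < i"
      using card step by (simp add: motzkin_step_def)
    then have "\<not> B \<subseteq> A" "\<not> A \<subseteq> B"
      using card by (auto simp: Int_absorb1 Int_absorb2)
    then obtain x y where xy: "x \<in> B" "x \<notin> A" "y \<in> A" "y \<notin> B"
      by blast
    then have "insert x A \<inter> insert y B = insert x (insert y (A \<inter> B))" "x \<noteq> y"
      by auto
    then show thesis
      using that[of "insert x A" "insert y B"] xy card 3 by auto
  qed
qed

text \<open>The remaining \<open>n - i\<close> steps must bring the path down to 0, by at most 1
  each; the induction therefore runs downwards from \<open>n\<close>.\<close>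

lemma motzkin_path_bound:
  fixes p :: "nat \<Rightarrow> int"
  assumes "p n = 0" "\<And>i. i < n \<Longrightarrow> motzkin_step (p i) (p (Suc i))" "i \<le> n"
  shows "int i + p i \<le> int n"
  using assms(3)
proof (induction rule: inc_induct)
  case base
  then show ?case using assms(1) by simp
next
  case (step j)
  then show ?case using assms(2)[of j] unfolding motzkin_step_def by linarith
qed

lemma ex_chains_along_path:
  fixes p :: "nat \<Rightarrow> int"
  assumes p0: "p 0 = 0" and pn: "p (CARD('n::finite)) = 0"
    and step: "\<And>i. i < CARD('n) \<Longrightarrow> motzkin_step (p i) (p (Suc i))"
  obtains A B :: "nat \<Rightarrow> 'n::finite set"
  where "mono A" "mono B" "\<forall>i\<le>CARD('n). card (A i) = i \<and> card (B i) = i"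
    "\<forall>i\<le>CARD('n). int (card (A i \<inter> B i)) = int i - p i"
proof -
  \<comment> \<open>Beyond \<open>CARD('n)\<close> the condition is vacuous, so that dependent
    choice yields an infinite chain, which may simply repeat its last pair there.\<close>
  define good where "good i C \<longleftrightarrow> i \<le> CARD('n) \<longrightarrow>
      card (fst C) = i \<and> card (snd C) = i \<and> int (card (fst C \<inter> snd C)) = int i - p i"
    for i and C :: "'n set \<times> 'n set"
  have "\<exists>f. \<forall>i. good i (f i) \<and> (fst (f i) \<subseteq> fst (f (Suc i)) \<and> snd (f i) \<subseteq> snd (f (Suc i)))"
  proof (rule dependent_nat_choice)
    show "\<exists>C. good 0 C"
      using p0 by (intro exI[of _ "({}, {})"]) (simp add: good_def)
  next
    fix C i
    assume C: "good i C"
    show "\<exists>D. good (Suc i) D \<and> (fst C \<subseteq> fst D \<and> snd C \<subseteq> snd D)"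
    proof (cases "i < CARD('n)")
      case True
      then have "card (fst C) = i" "card (snd C) = i" "int (card (fst C \<inter> snd C)) = int i - p i"
        using C by (auto simp: good_def)
      moreover note step[OF True]
      moreover have "int (Suc i) + p (Suc i) \<le> int (CARD('n))"
        using motzkin_path_bound[of p "CARD('n)" "Suc i"] pn step True by simp
      ultimately obtain A' B' where "fst C \<subseteq> A'" "snd C \<subseteq> B'" "card A' = Suc i" "card B' = Suc i"
        "int (card (A' \<inter> B')) = int (Suc i) - p (Suc i)"
        by (rule extend_sets_along_step)
      then show ?thesis
        by (intro exI[of _ "(A', B')"]) (simp add: good_def)
    next
      case False
      then show ?thesis
        by (intro exI[of _ C]) (simp add: good_def)
    qed
  qed
  then obtain f where "\<And>i. good i (f i)"
    "\<And>i. fst (f i) \<subseteq> fst (f (Suc i))" "\<And>i. snd (f i) \<subseteq> snd (f (Suc i))"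
    by blast
  then show thesis
    using that[of "fst \<circ> f" "snd \<circ> f"] by (auto simp: good_def mono_iff_le_Suc)
qed

text \<open>This is the span of the standard basis vectors with index in \<open>A\<close>; it turns
  cardinalities into dimensions and respects intersections.\<close>

definition coord_subspace :: "'n set \<Rightarrow> ('a::field ^ 'n) set" where
  "coord_subspace A = {x. \<forall>i. i \<notin> A \<longrightarrow> x $ i = 0}"

lemma subspace_coord_subspace: "vec.subspace (coord_subspace A)"
  by (auto simp: coord_subspace_def vec.subspace_def)

lemma dim_coord_subspace: "vec.dim (coord_subspace A) = card A"
  by (simp add: coord_subspace_def dim_substandard_cart)

lemma coord_subspace_Int: "coord_subspace A \<inter> coord_subspace B = coord_subspace (A \<inter> B)"
  by (auto simp: coord_subspace_def)

lemma coord_subspace_mono: "A \<subseteq> B \<Longrightarrow> coord_subspace A \<subseteq> coord_subspace B"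
  by (auto simp: coord_subspace_def)

lemma coord_flag_in_full_flags:
  fixes A :: "nat \<Rightarrow> 'n::finite set"
  assumes "mono A" "\<And>i. i \<le> CARD('n) \<Longrightarrow> card (A i) = i"
  shows "map (\<lambda>i. coord_subspace (A i) :: ('a::field ^ 'n) set) [1..<CARD('n)] \<in> full_flags"
proof -
  have "(coord_subspace (A i) :: ('a ^ 'n) set) \<subset> coord_subspace (A j)"
    if "i < j" "j < CARD('n)" for i j
  proof
    show "(coord_subspace (A i) :: ('a ^ 'n) set) \<subseteq> coord_subspace (A j)"
      using assms(1) that by (intro coord_subspace_mono monoD[of A]) auto
    have "vec.dim (coord_subspace (A i) :: ('a ^ 'n) set) \<noteq> vec.dim (coord_subspace (A j) :: ('a ^ 'n) set)"
      using assms(2)[of i] assms(2)[of j] that by (simp add: dim_coord_subspace)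
    then show "(coord_subspace (A i) :: ('a ^ 'n) set) \<noteq> coord_subspace (A j)"
      by metis
  qed
  then show ?thesis
    using assms(2)
    by (auto simp: full_flags_def sorted_wrt_iff_nth_less subspace_coord_subspace dim_coord_subspace)
qed

lemma motzkin_path_is_distance_vector:
  assumes "d \<in> motzkin_paths 0 (CARD('n::finite) - 1)"
  shows "d \<in> distance_vectors TYPE('a::field) TYPE('n)"
proof -
  \<comment> \<open>The height after \<open>i\<close> steps, both end points included, so position
    \<open>i\<close> of \<open>d\<close> is \<open>p (Suc i)\<close>.\<close>
  define p where "p i = (0 # d @ [0]) ! i" for i
  have len: "length d = CARD('n) - 1" and succ: "successively motzkin_step (0 # d @ [0])"
    using assms by (auto simp: motzkin_paths_def)
  have pos: "0 < CARD('n)" by simp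
  have "p 0 = 0" "p (CARD('n)) = 0"
    using len pos by (simp_all add: p_def nth_append nth_Cons')
  moreover have "motzkin_step (p i) (p (Suc i))" if "i < CARD('n)" for i
    unfolding p_def using that len by (intro successively_nth[OF succ]) auto
  ultimately obtain A B :: "nat \<Rightarrow> 'n set"
    where mono: "mono A" "mono B" and card: "\<forall>i\<le>CARD('n). card (A i) = i \<and> card (B i) = i"
      and Int: "\<forall>i\<le>CARD('n). int (card (A i \<inter> B i)) = int i - p i"
    by (rule ex_chains_along_path)
  let ?F = "map (\<lambda>i. coord_subspace (A i) :: ('a ^ 'n) set) [1..<CARD('n)]"
  let ?F' = "map (\<lambda>i. coord_subspace (B i) :: ('a ^ 'n) set) [1..<CARD('n)]"
  have "d = distance_vector ?F ?F'"
  proof (rule nth_equalityI)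
    show "length d = length (distance_vector ?F ?F')"
      using len by (simp add: distance_vector_def)
  next
    fix i
    assume i: "i < length d"
    then have "d ! i = p (Suc i)"
      by (simp add: p_def nth_append)
    then show "d ! i = distance_vector ?F ?F' ! i"
      using i len card Int
      by (simp add: distance_vector_def injection_dist_def coord_subspace_Int dim_coord_subspace)
  qed
  then show ?thesis
    using coord_flag_in_full_flags[OF mono(1)] coord_flag_in_full_flags[OF mono(2)] card
    unfolding distance_vectors_def by blast
qed

theorem corollary4p4:
  fixes q n :: nat
  assumes "CARD('a::{field,finite}) = q"
    and "CARD('n::finite) = n"
    and "n \<ge> 2"
  shows "card (distance_vectors TYPE('a) TYPE('n)) = motzkin n"
proof -
  \<comment> \<open>The right-hand side does not mention the field, so the count depends on
    \<open>n\<close> only.\<close>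
  have "distance_vectors TYPE('a) TYPE('n) = motzkin_paths 0 (n - 1)"
    using distance_vector_in_motzkin_paths motzkin_path_is_distance_vector assms(2)
    unfolding distance_vectors_def by (auto simp: distance_vectors_def)
  then show ?thesis
    using card_motzkin_paths[of "n - 1"] assms(3) by (simp del: motzkin.simps)
qed

end
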